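(* Let $R\ge 2$ be an integer. Then $$\nu_+^*(R)\ \le\ e\,(R\log R+\log R+\log\log R+4),$$ where $\log$ is the natural logarithm and $\nu_+^*(R)$ is the asymptotic worst-case density of normal asymmetric binary covering codes of radius $R$ (defined in the context).
   Context: Let $Q_n=\{0,1\}^n$, partially ordered by $x\preceq y$ iff $x_i\le y_i$ for all $i$. The Hamming distance $d(x,y)$ is the number of coordinates in which $x$ and $y$ differ. For $x\in Q_n$ and $Y\subseteq Q_n$ the asymmetric distance is $d^+(x,Y)=\min\{d(x,y):y\in Y,\ x\preceq y\}$, equal to $\infty$ if there is no such $y$. The asymmetric covering radius of $\mathcal C\subseteq Q_n$ is the smallest integer $R\ge0$ such that $d^+(x,\mathcal C)\le R$ for all $x\in Q_n$; an $(n,R)^+$-code is a set $\mathcal C\subseteq Q_n$ with asymmetric covering radius $R$. For $X\subseteq Q_n$, $i\in\{1,\dots,n\}$ and $b\in\{0,1\}$ put $X^{(i)}_b=\{x\in X: x_i=b\}$. The asymmetric norm of $\mathcal C$ with respect to coordinate $i$ is $$N^{(i)}(\mathcal C)=\max\Big\{\max_{x\in (Q_n)^{(i)}_0}\{d^+(x,\mathcal C^{(i)}_0)+d^+(x,\mathcal C^{(i)}_1)\},\ \max_{x\in (Q_n)^{(i)}_1}\{2\,d^+(x,\mathcal C^{(i)}_1)+1\}\Big\},$$ and the minimum asymmetric norm is $N_{\min}(\mathcal C)=\min_{1\le i\le n}N^{(i)}(\mathcal C)$. An $(n,R)^+$-code is (asymmetric) normal if $N_{\min}(\mathcal C)\le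 2R+1$ and $N_{\min}(\mathcal C)\in\{2R,2R+1\}$. $K^+_\nu(n,R)$ is the minimum size of a normal $(n,R)^+$-code, $\binom{m}{\le R}=\sum_{i=0}^R\binom mi$, $\nu_+(n,R)=\dfrac{K^+_\nu(n,R)}{2^n/\binom{\lfloor n/2\rfloor}{\le R}}$, and $\nu_+^*(R)=\limsup_{n\to\infty}\nu_+(n,R)$. *)

theory Defs
  imports Complex_Main "HOL-Library.FuncSet" "HOL-Library.Extended_Nat"
    "HOL-Library.Extended_Real" "HOL-Library.Liminf_Limsup"
begin

text \<open>
  Minima and maxima of distances are written as infima and suprema in \<^typ>\<open>enat\<close>. Over a nonempty
  set the infimum is attained, all the suprema range over finite sets, and the infimum over the
  empty set is \<open>\<infinity>\<close>.
\<close>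

definition cube :: "nat \<Rightarrow> (nat \<Rightarrow> nat) set" where
  "cube n = {1..n} \<rightarrow>\<^sub>E {0, 1}"

definition cube_le :: "nat \<Rightarrow> (nat \<Rightarrow> nat) \<Rightarrow> (nat \<Rightarrow> nat) \<Rightarrow> bool" where
  "cube_le n x y \<longleftrightarrow> (\<forall>i\<in>{1..n}. x i \<le> y i)"

definition hamming_dist :: "nat \<Rightarrow> (nat \<Rightarrow> nat) \<Rightarrow> (nat \<Rightarrow> nat) \<Rightarrow> nat" where
  "hamming_dist n x y = card {i\<in>{1..n}. x i \<noteq> y i}"

definition asym_dist :: "nat \<Rightarrow> (nat \<Rightarrow> nat) \<Rightarrow> (nat \<Rightarrow> nat) set \<Rightarrow> enat" where
  "asym_dist n x Y = (INF y\<in>{y\<in>Y. cube_le n x y}. enat (hamming_dist n x y))"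

text \<open>The radius is \<open>\<infinity>\<close> if some point of the cube lies below no codeword.\<close>

definition asym_covering_radius :: "nat \<Rightarrow> (nat \<Rightarrow> nat) set \<Rightarrow> enat" where
  "asym_covering_radius n C = (INF R\<in>{R. \<forall>x\<in>cube n. asym_dist n x C \<le> enat R}. enat R)"

definition asym_code :: "nat \<Rightarrow> nat \<Rightarrow> (nat \<Rightarrow> nat) set \<Rightarrow> bool" where
  "asym_code n R C \<longleftrightarrow> C \<subseteq> cube n \<and> asym_covering_radius n C = enat R"

definition slice :: "(nat \<Rightarrow> nat) set \<Rightarrow> nat \<Rightarrow> nat \<Rightarrow> (nat \<Rightarrow> nat) set" where
  "slice X i b = {x\<in>X. x i = b}"

definition asym_norm :: "nat \<Rightarrow> (nat \<Rightarrow> nat) set \<Rightarrow> nat \<Rightarrow> enat" where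
  "asym_norm n C i =
     max (SUP x\<in>slice (cube n) i 0. asym_dist n x (slice C i 0) + asym_dist n x (slice C i 1))
         (SUP x\<in>slice (cube n) i 1. 2 * asym_dist n x (slice C i 1) + 1)"

definition min_asym_norm :: "nat \<Rightarrow> (nat \<Rightarrow> nat) set \<Rightarrow> enat" where
  "min_asym_norm n C = (INF i\<in>{1..n}. asym_norm n C i)"

definition normal_asym_code :: "nat \<Rightarrow> nat \<Rightarrow> (nat \<Rightarrow> nat) set \<Rightarrow> bool" where
  "normal_asym_code n R C \<longleftrightarrow>
     asym_code n R C \<and> min_asym_norm n C \<le> enat (2 * R + 1) \<and>
     min_asym_norm n C \<in> {enat (2 * R), enat (2 * R + 1)}"

text \<open>
  Extended values are used here so that the minimum size, and with it the density, is \<open>\<infinity>\<close>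
  (and not \<open>0\<close>) for those \<open>n\<close> for which there is no normal code.
\<close>

definition K_normal :: "nat \<Rightarrow> nat \<Rightarrow> enat" where
  "K_normal n R = (INF C\<in>{C. normal_asym_code n R C}. enat (card C))"

definition binomial_upto :: "nat \<Rightarrow> nat \<Rightarrow> nat" where
  "binomial_upto m R = (\<Sum>i\<le>R. m choose i)"

definition normal_density :: "nat \<Rightarrow> nat \<Rightarrow> ereal" where
  "normal_density n R =
     ereal_of_enat (K_normal n R) / ereal (2 ^ n / real (binomial_upto (n div 2) R))"

definition limsup_normal_density :: "nat \<Rightarrow> ereal" where
  "limsup_normal_density R = limsup (\<lambda>n. normal_density n R)"

end

theory Submission imports Defs "HOL-Real_Asymp.Real_Asymp" begin

text \<open>
  Split the coordinates \<open>{1..n}\<close> into a short block \<open>I = {1..m}\<close> with \<open>m = n div (R + 1)\<close> and the long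
  block \<open>J\<close> of the other \<open>N = n - m\<close> coordinates. In the cube over \<open>J\<close>, about
  \<open>x 2^N / binomial_upto (N div 2) R\<close> points, chosen greedily, form a set \<open>K\<close> that covers all but a
  fraction of about \<open>exp (- x)\<close> of the points within asymmetric distance \<open>R\<close>
  (\<open>exists_partial_cover\<close>). Let \<open>S\<close> be the set of uncovered points and let \<open>D\<close> be an optimal code
  over \<open>I\<close>. Then the union of \<open>K\<close> times the whole cube over \<open>I\<close> and of \<open>S\<close> times \<open>D\<close> is a code of
  length \<open>n\<close>.

  This construction preserves normality (\<open>normal_at_amalgam\<close>). Take \<open>i \<in> I\<close> for which \<open>D\<close> has norm
  at most \<open>2 * R + 1\<close>. Above a point with \<open>J\<close>-part in \<open>S\<close> use the codewords of \<open>D\<close>. If the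
  \<open>J\<close>-part is covered by \<open>K\<close>, the \<open>I\<close>-part can be kept, or it can be changed in the coordinate \<open>i\<close>
  only, which gives codewords with both values of that coordinate at distances \<open>R\<close> and \<open>R + 1\<close>.

  Let \<open>f n\<close> be the least density of a code that has norm at most \<open>2 * R + 1\<close> in some coordinate.
  Comparing \<open>binomial_upto (n div 2) R\<close> with its analogues for \<open>N\<close> and \<open>m\<close> coordinates costs factors
  \<open>(1 + 1/R)^R < e\<close> and \<open>(R + 1)^R < e R^R\<close> in the limit, so that eventually
  \<open>f n \<le> e x + exp (1 - x) R^R f m\<close> (\<open>min_density_eventually_rec\<close>). For
  \<open>x = R ln R + ln R + ln (ln R) + 2\<close> the coefficient of \<open>f m\<close> is \<open>c = 1 / (e R ln R)\<close>, and iterating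
  the inequality gives the asymptotic bound \<open>e x / (1 - c)\<close>, which is less than \<open>e (x + 2)\<close>.

  A code of norm at most \<open>2 * R + 1\<close> in one coordinate has covering radius at most \<open>R\<close>. A smaller
  radius would need at least \<open>2^n / binomial_upto n (R - 1)\<close> codewords, a factor of order \<open>n\<close> more
  than a code of bounded density has. A radius of exactly \<open>R\<close> forces every norm to be at least
  \<open>2 * R\<close>. Hence for large \<open>n\<close> these codes are normal (\<open>normal_code_of_normal_at\<close>).
\<close>

section \<open>Cubes over finite index sets\<close>

abbreviation bit_cube :: "nat set \<Rightarrow> (nat \<Rightarrow> nat) set" where
  "bit_cube J \<equiv> J \<rightarrow>\<^sub>E {0, 1}"

text \<open>
  The point \<open>y\<close> shows that \<open>x\<close> has asymmetric distance at most \<open>r\<close> from any set containing \<open>y\<close>. The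
  index set is a parameter because the construction works over the blocks of a partition of the
  coordinates.
\<close>

definition below_within :: "nat set \<Rightarrow> nat \<Rightarrow> (nat \<Rightarrow> nat) \<Rightarrow> (nat \<Rightarrow> nat) \<Rightarrow> bool" where
  "below_within J r x y \<longleftrightarrow> (\<forall>j\<in>J. x j \<le> y j) \<and> card {j\<in>J. x j \<noteq> y j} \<le> r"

lemma finite_bit_cube: "finite J \<Longrightarrow> finite (bit_cube J)"
  by (simp add: finite_PiE)

lemma card_bit_cube: "finite J \<Longrightarrow> card (bit_cube J) = 2 ^ card J"
  by (simp add: card_PiE numeral_2_eq_2)

lemma bit_cube_cases: "x \<in> bit_cube J \<Longrightarrow> j \<in> J \<Longrightarrow> x j = 0 \<or> x j = 1"
  by (auto simp: PiE_iff)

lemma below_within_refl: "below_within J r x x"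
  by (simp add: below_within_def)

lemma below_within_cong:
  assumes "below_within J r x y" "\<And>j. j \<in> J \<Longrightarrow> x j = x' j" "\<And>j. j \<in> J \<Longrightarrow> y j = y' j"
  shows "below_within J r x' y'"
proof -
  have "{j\<in>J. x j \<noteq> y j} = {j\<in>J. x' j \<noteq> y' j}" using assms(2,3) by auto
  then show ?thesis using assms unfolding below_within_def by auto
qed

lemma below_within_Un:
  assumes "below_within I a x y" "below_within J b x y" "finite I" "finite J"
  shows "below_within (I \<union> J) (a + b) x y"
proof -
  have "{j \<in> I \<union> J. x j \<noteq> y j} = {j\<in>I. x j \<noteq> y j} \<union> {j\<in>J. x j \<noteq> y j}" by auto
  then have "card {j \<in> I \<union> J. x j \<noteq> y j} \<le> card {j\<in>I. x j \<noteq> y j} + card {j\<in>J. x j \<noteq> y j}"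
    by (simp add: card_Un_le)
  then show ?thesis using assms unfolding below_within_def by auto
qed

lemma card_subsets_upto:
  assumes "finite Z"
  shows "card {A. A \<subseteq> Z \<and> card A \<le> R} = binomial_upto (card Z) R"
proof -
  have "{A. A \<subseteq> Z \<and> card A \<le> R} = (\<Union>i\<le>R. {A. A \<subseteq> Z \<and> card A = i})" by auto
  also have "card \<dots> = (\<Sum>i\<le>R. card {A. A \<subseteq> Z \<and> card A = i})"
    by (rule card_UN_disjoint) (use assms in auto)
  also have "\<dots> = binomial_upto (card Z) R"
    using assms by (simp add: binomial_upto_def n_subsets)
  finally show ?thesis .
qed

lemma binomial_upto_pos: "binomial_upto k R \<ge> 1"
proof -
  have "(k choose 0) \<le> (\<Sum>i\<le>R. k choose i)" by (rule member_le_sum) auto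
  then show ?thesis by (simp add: binomial_upto_def)
qed

lemma binomial_upto_mono: "k \<le> l \<Longrightarrow> binomial_upto k R \<le> binomial_upto l R"
  unfolding binomial_upto_def by (intro sum_mono binomial_right_mono)

text \<open>
  The points above \<open>u\<close> arise by raising a set of zeros of \<open>u\<close>, so that the number of zeros determines
  how many points lie within distance \<open>R\<close> above \<open>u\<close>.
\<close>

lemma card_points_above:
  assumes J: "finite J" and u: "u \<in> bit_cube J"
  shows "binomial_upto (card {j\<in>J. u j = 0}) R \<le> card {y\<in>bit_cube J. below_within J R u y}"
proof -
  define Z where "Z = {j\<in>J. u j = 0}"
  define g where "g A = (\<lambda>j. if j \<in> A then 1 else u j)" for A
  have diff: "{j\<in>J. u j \<noteq> g A j} = A" if "A \<subseteq> Z" for A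
    using that by (auto simp: g_def Z_def)
  have "card {A. A \<subseteq> Z \<and> card A \<le> R} \<le> card {y\<in>bit_cube J. below_within J R u y}"
  proof (rule card_inj_on_le)
    show "inj_on g {A. A \<subseteq> Z \<and> card A \<le> R}"
      by (rule inj_on_inverseI[where g = "\<lambda>y. {j\<in>J. u j \<noteq> y j}"]) (simp add: diff)
    show "g ` {A. A \<subseteq> Z \<and> card A \<le> R} \<subseteq> {y\<in>bit_cube J. below_within J R u y}"
    proof clarify
      fix A assume A: "A \<subseteq> Z" "card A \<le> R"
      have "g A \<in> bit_cube J"
        using u A by (auto simp: g_def Z_def PiE_iff extensional_def)
      moreover have "\<forall>j\<in>J. u j \<le> g A j"
        using A by (auto simp: g_def Z_def)
      ultimately show "g A \<in> bit_cube J \<and> below_within J R u (g A)"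
        using A diff[OF A(1)] by (simp add: below_within_def)
    qed
    show "finite {y\<in>bit_cube J. below_within J R u y}"
      using finite_bit_cube[OF J] by simp
  qed
  moreover have "finite Z" using J by (simp add: Z_def)
  ultimately show ?thesis
    using card_subsets_upto[of Z R] by (simp add: Z_def)
qed

lemma card_points_below:
  assumes J: "finite J" and y: "y \<in> bit_cube J"
  shows "card {x\<in>bit_cube J. below_within J r x y} \<le> binomial_upto (card J) r"
proof -
  have "card {x\<in>bit_cube J. below_within J r x y} \<le> card {A. A \<subseteq> J \<and> card A \<le> r}"
  proof (rule card_inj_on_le)
    show "inj_on (\<lambda>x. {j\<in>J. x j \<noteq> y j}) {x\<in>bit_cube J. below_within J r x y}"
    proof (rule inj_onI)
      fix x x' assume x: "x \<in> {x\<in>bit_cube J. below_within J r x y}"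
        and x': "x' \<in> {x\<in>bit_cube J. below_within J r x y}"
        and eq: "{j\<in>J. x j \<noteq> y j} = {j\<in>J. x' j \<noteq> y j}"
      show "x = x'"
      proof (rule PiE_ext)
        show "x \<in> bit_cube J" "x' \<in> bit_cube J" using x x' by auto
        fix j assume j: "j \<in> J"
        with eq have "x j \<noteq> y j \<longleftrightarrow> x' j \<noteq> y j" by blast
        then show "x j = x' j"
          using bit_cube_cases[of x J j] bit_cube_cases[of x' J j] bit_cube_cases[OF y j] x x' j
          by auto
      qed
    qed
    show "(\<lambda>x. {j\<in>J. x j \<noteq> y j}) ` {x\<in>bit_cube J. below_within J r x y}
        \<subseteq> {A. A \<subseteq> J \<and> card A \<le> r}"
      by (auto simp: below_within_def)
    show "finite {A. A \<subseteq> J \<and> card A \<le> r}" using J by simp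
  qed
  then show ?thesis using card_subsets_upto[OF J] by simp
qed

text \<open>
  The variance computation for a sum of independent signs \<open>1 - 2 * x j\<close>, as a sum over the cube.
\<close>

lemma second_moment_bit_cube:
  assumes "finite J"
  shows "(\<Sum>x\<in>bit_cube J. (\<Sum>j\<in>J. 1 - 2 * real (x j))\<^sup>2) = real (card J) * 2 ^ card J"
  using assms
proof (induction J rule: finite_induct)
  case empty
  then show ?case by simp
next
  case (insert i J)
  define s where "s x = (\<Sum>j\<in>J. 1 - 2 * real (x j))" for x :: "nat \<Rightarrow> nat"
  have s_upd: "s (x(i := a)) = s x" for x a
    unfolding s_def by (rule sum.cong) (use insert.hyps in auto)
  have "(\<Sum>x\<in>bit_cube (insert i J). (\<Sum>j\<in>insert i J. 1 - 2 * real (x j))\<^sup>2)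
      = (\<Sum>x\<in>bit_cube (insert i J). (1 - 2 * real (x i) + s x)\<^sup>2)"
    using insert.hyps by (simp add: s_def)
  also have "\<dots> = (\<Sum>(a, x)\<in>{0, 1} \<times> bit_cube J. (1 - 2 * real a + s x)\<^sup>2)"
    unfolding PiE_insert_eq
    by (subst sum.reindex[OF inj_combinator[OF insert.hyps(2)]])
      (auto simp: s_upd intro!: sum.cong)
  also have "\<dots> = (\<Sum>x\<in>bit_cube J. (1 + s x)\<^sup>2) + (\<Sum>x\<in>bit_cube J. (s x - 1)\<^sup>2)"
    by (simp add: sum.cartesian_product[symmetric] algebra_simps)
  also have "\<dots> = (\<Sum>x\<in>bit_cube J. 2 * (s x)\<^sup>2 + 2)"
    by (simp add: sum.distrib[symmetric] power2_eq_square algebra_simps)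
  also have "\<dots> = 2 * (\<Sum>x\<in>bit_cube J. (s x)\<^sup>2) + 2 * 2 ^ card J"
    using card_bit_cube[OF insert.hyps(1)] by (simp add: sum.distrib sum_distrib_left)
  also have "\<dots> = real (card (insert i J)) * 2 ^ card (insert i J)"
    using insert by (simp add: s_def algebra_simps)
  finally show ?case .
qed

text \<open>
  Chebyshev's inequality. The points with noticeably fewer than half of their coordinates zero have
  too few points above them to be covered efficiently, but they are a vanishing fraction of the cube.
\<close>

lemma card_few_zeros:
  assumes J: "finite J" and k: "2 * k < card J"
  shows "real (card {x\<in>bit_cube J. card {j\<in>J. x j = 0} < k})
    \<le> 2 ^ card J * (real (card J) / (real (card J) - 2 * real k)\<^sup>2)"
proof -
  define T where "T = {x\<in>bit_cube J. card {j\<in>J. x j = 0} < k}"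
  define d where "d = real (card J) - 2 * real k"
  have d: "d > 0" using k by (simp add: d_def)
  have sum_eq: "(\<Sum>j\<in>J. 1 - 2 * real (x j)) = 2 * real (card {j\<in>J. x j = 0}) - real (card J)"
    if "x \<in> bit_cube J" for x
  proof -
    have "(\<Sum>j\<in>J. 1 - 2 * real (x j)) = (\<Sum>j\<in>J. 2 * (if x j = 0 then 1 else 0) - 1)"
      by (rule sum.cong) (use bit_cube_cases[OF that] in force)+
    also have "\<dots> = 2 * (\<Sum>j\<in>J. if x j = 0 then 1 else 0) - real (card J)"
      by (simp add: sum_subtractf sum_distrib_left)
    also have "(\<Sum>j\<in>J. if x j = 0 then 1 else 0) = real (card {j\<in>J. x j = 0})"
      using J by (simp add: sum.If_cases Int_def)
    finally show ?thesis .
  qed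
  have "real (card T) * d\<^sup>2 = (\<Sum>x\<in>T. d\<^sup>2)" by simp
  also have "\<dots> \<le> (\<Sum>x\<in>T. (\<Sum>j\<in>J. 1 - 2 * real (x j))\<^sup>2)"
  proof (rule sum_mono)
    fix x assume x: "x \<in> T"
    then have "d \<le> real (card J) - 2 * real (card {j\<in>J. x j = 0})"
      by (simp add: T_def d_def)
    then have "d\<^sup>2 \<le> (real (card J) - 2 * real (card {j\<in>J. x j = 0}))\<^sup>2"
      using d by (intro power_mono) auto
    then show "d\<^sup>2 \<le> (\<Sum>j\<in>J. 1 - 2 * real (x j))\<^sup>2"
      using x sum_eq[of x] by (simp add: T_def power2_commute)
  qed
  also have "\<dots> \<le> (\<Sum>x\<in>bit_cube J. (\<Sum>j\<in>J. 1 - 2 * real (x j))\<^sup>2)"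
    by (rule sum_mono2) (use finite_bit_cube[OF J] in \<open>auto simp: T_def\<close>)
  also have "\<dots> = real (card J) * 2 ^ card J" by (rule second_moment_bit_cube[OF J])
  finally have "real (card T) \<le> real (card J) * 2 ^ card J / d\<^sup>2"
    using d by (simp add: pos_le_divide_eq)
  then show ?thesis by (simp add: T_def d_def mult.commute)
qed

section \<open>Greedy partial covers\<close>

text \<open>
  By averaging, some \<open>y\<close> is related to at least the fraction \<open>b / card Y\<close> of the points not covered
  yet. Adding such a \<open>y\<close> multiplies the number of uncovered points by at most
  \<open>1 - b / card Y \<le> exp (- b / card Y)\<close>.
\<close>

lemma exists_partial_cover:
  fixes r :: "'a \<Rightarrow> 'b \<Rightarrow> bool"
  assumes T: "finite T" and Y: "finite Y" "Y \<noteq> {}"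
    and deg: "\<And>u. u \<in> T \<Longrightarrow> b \<le> card {y\<in>Y. r u y}"
  shows "\<exists>K\<subseteq>Y. card K \<le> M \<and>
    real (card {u\<in>T. \<forall>y\<in>K. \<not> r u y}) \<le> exp (- (real M * real b / real (card Y))) * real (card T)"
proof (induction M)
  case 0
  show ?case by (rule exI[of _ "{}"]) auto
next
  case (Suc M)
  then obtain K where K: "K \<subseteq> Y" "card K \<le> M" and
    UK: "real (card {u\<in>T. \<forall>y\<in>K. \<not> r u y})
      \<le> exp (- (real M * real b / real (card Y))) * real (card T)" by blast
  define U where "U = {u\<in>T. \<forall>y\<in>K. \<not> r u y}"
  define N where "N = card Y"
  have N: "N > 0" using Y by (simp add: N_def card_gt_0_iff)
  have fU: "finite U" using T by (simp add: U_def)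
  \<comment> \<open>Otherwise double counting the related pairs in \<open>U\<close> and \<open>Y\<close> contradicts the degree bound.\<close>
  have "\<exists>y\<in>Y. real b * real (card U) / real N \<le> real (card {u\<in>U. r u y})"
  proof (rule ccontr)
    assume "\<not> ?thesis"
    then have "(\<Sum>y\<in>Y. real (card {u\<in>U. r u y})) < (\<Sum>y\<in>Y. real b * real (card U) / real N)"
      using Y by (intro sum_strict_mono) auto
    also have "\<dots> = real b * real (card U)" using N by (simp add: N_def)
    also have "\<dots> = (\<Sum>u\<in>U. real b)" by simp
    also have "\<dots> \<le> (\<Sum>u\<in>U. real (card {y\<in>Y. r u y}))"
      by (intro sum_mono) (use deg in \<open>auto simp: U_def\<close>)
    also have "\<dots> = (\<Sum>y\<in>Y. real (card {u\<in>U. r u y}))"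
      using sum.swap_restrict[OF fU Y(1), of "\<lambda>_ _. 1::real" r] by simp
    finally show False by simp
  qed
  then obtain y where y: "y \<in> Y"
    and avg: "real b * real (card U) / real N \<le> real (card {u\<in>U. r u y})" by blast
  have "{u\<in>T. \<forall>y'\<in>insert y K. \<not> r u y'} = U - {u\<in>U. r u y}" by (auto simp: U_def)
  then have "real (card {u\<in>T. \<forall>y'\<in>insert y K. \<not> r u y'})
      = real (card U) - real (card {u\<in>U. r u y})"
    using fU by (simp add: card_Diff_subset card_mono of_nat_diff)
  also have "\<dots> \<le> (1 + - (real b / real N)) * real (card U)"
    using avg by (simp add: algebra_simps)
  also have "\<dots> \<le> exp (- (real b / real N)) * real (card U)"
    by (intro mult_right_mono exp_ge_add_one_self) auto
  also have "\<dots> \<le> exp (- (real b / real N))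
      * (exp (- (real M * real b / real N)) * real (card T))"
    using UK by (intro mult_left_mono) (auto simp: U_def N_def)
  also have "\<dots> = exp (- (real (Suc M) * real b / real N)) * real (card T)"
  proof -
    have "- (real (Suc M) * real b / real N) = - (real b / real N) + - (real M * real b / real N)"
      by (simp add: distrib_right add_divide_distrib)
    then show ?thesis by (simp only: exp_add mult.assoc)
  qed
  finally have uncovered: "real (card {u\<in>T. \<forall>y'\<in>insert y K. \<not> r u y'})
      \<le> exp (- (real (Suc M) * real b / real (card Y))) * real (card T)"
    unfolding N_def .
  have "card (insert y K) \<le> Suc M"
    using K(2) card_insert_le_m1[of "Suc M" K y] by simp
  then show ?case
    using K(1) y uncovered by (intro exI[of _ "insert y K"] conjI) auto
qed

section \<open>Codes of small norm in one coordinate\<close>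

text \<open>
  The norm of \<open>C\<close> with respect to the coordinate \<open>i\<close> is at most \<open>2 * R + 1\<close>, expressed by witnesses
  in place of infima of distances.
\<close>

definition normal_at :: "nat \<Rightarrow> nat \<Rightarrow> (nat \<Rightarrow> nat) set \<Rightarrow> nat \<Rightarrow> bool" where
  "normal_at n R C i \<longleftrightarrow> C \<subseteq> cube n \<and> i \<in> {1..n} \<and>
     (\<forall>x\<in>cube n.
       (x i = 0 \<longrightarrow> (\<exists>a b. a + b \<le> 2 * R + 1 \<and>
          (\<exists>y\<in>C. y i = 0 \<and> below_within {1..n} a x y) \<and>
          (\<exists>y\<in>C. y i = 1 \<and> below_within {1..n} b x y))) \<and>
       (x i = 1 \<longrightarrow> (\<exists>y\<in>C. y i = 1 \<and> below_within {1..n} R x y)))"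

lemma cube_eq: "cube n = bit_cube {1..n}"
  by (simp add: cube_def)

lemma finite_cube: "finite (cube n)"
  unfolding cube_eq by (rule finite_bit_cube) simp

lemma card_cube: "card (cube n) = 2 ^ n"
  unfolding cube_eq by (subst card_bit_cube) auto

lemma below_within_raise:
  assumes "below_within J r x y" "i \<in> J" "x i = 0" "finite J"
  shows "below_within J (r + 1) x (y(i := 1))"
proof -
  have "{j\<in>J. x j \<noteq> (y(i := 1)) j} \<subseteq> insert i {j\<in>J. x j \<noteq> y j}" by auto
  then have "card {j\<in>J. x j \<noteq> (y(i := 1)) j} \<le> card (insert i {j\<in>J. x j \<noteq> y j})"
    by (rule card_mono[rotated]) (use assms in auto)
  also have "\<dots> \<le> Suc (card {j\<in>J. x j \<noteq> y j})"
    by (rule card_insert_le_m1) auto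
  finally show ?thesis using assms unfolding below_within_def by auto
qed

lemma cube_upd: "x \<in> cube n \<Longrightarrow> i \<in> {1..n} \<Longrightarrow> x(i := 1) \<in> cube n"
  by (auto simp: cube_eq PiE_iff extensional_def)

lemma normal_at_cube:
  assumes "n \<ge> 1"
  shows "normal_at n R (cube n) 1"
  unfolding normal_at_def
proof (intro conjI ballI impI)
  fix x assume x: "x \<in> cube n"
  {
    assume x0: "x 1 = 0"
    have "x(1 := 1) \<in> cube n" using cube_upd[OF x] assms by simp
    moreover have "below_within {1..n} (0 + 1) x (x(1 := 1))"
      by (rule below_within_raise) (use assms x0 in \<open>auto intro: below_within_refl\<close>)
    ultimately have "\<exists>y\<in>cube n. y 1 = 1 \<and> below_within {1..n} 1 x y"
      by (intro bexI[of _ "x(1 := 1)"]) auto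
    then show "\<exists>a b. a + b \<le> 2 * R + 1 \<and>
          (\<exists>y\<in>cube n. y 1 = 0 \<and> below_within {1..n} a x y) \<and>
          (\<exists>y\<in>cube n. y 1 = 1 \<and> below_within {1..n} b x y)"
      using x x0 below_within_refl[of "{1..n}" 0 x]
      by - (rule exI[of _ 0], rule exI[of _ 1], auto)
  }
  show "x 1 = 1 \<Longrightarrow> \<exists>y\<in>cube n. y 1 = 1 \<and> below_within {1..n} R x y"
    using x by (auto intro: below_within_refl)
qed (use assms in auto)

text \<open>
  The recursive construction. The distances of the two parts of a point add up. Where \<open>K\<close> covers the
  \<open>J\<close>-part, the \<open>I\<close>-part of the codeword is free, so it can agree with the given point, or differ from
  it by one raised bit at \<open>i\<close>; both values of the coordinate \<open>i\<close> are then available at total cost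
  \<open>R + (R + 1)\<close>. Where \<open>K\<close> fails, the \<open>J\<close>-part is kept and the distances are those for \<open>D\<close>.
\<close>

lemma normal_at_amalgam:
  assumes D: "normal_at m R D i" and mn: "m \<le> n" and J: "J = {m+1..n}"
    and K: "K \<subseteq> bit_cube J"
    and S: "S = {u\<in>bit_cube J. \<forall>y\<in>K. \<not> below_within J R u y}"
  obtains C where "normal_at n R C i" "card C \<le> card K * 2 ^ m + card S * card D"
proof -
  define I where "I = {1..m}"
  define A where "A = {x\<in>cube n. restrict x J \<in> K}"
  define B where "B = {x\<in>cube n. restrict x J \<in> S \<and> restrict x I \<in> D}"
  have IJ: "I \<union> J = {1..n}" "I \<inter> J = {}" "finite I" "finite J"
    using mn J by (auto simp: I_def)
  have DI: "D \<subseteq> bit_cube I" and i: "i \<in> I"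
    using D by (auto simp: normal_at_def cube_eq I_def)
  have restr: "restrict x I \<in> bit_cube I" "restrict x J \<in> bit_cube J" if "x \<in> cube n" for x
    using that IJ by (auto simp: cube_eq PiE_iff)
  have fin: "finite K" "finite S" "finite D"
    using K S DI finite_bit_cube[OF IJ(3)] finite_bit_cube[OF IJ(4)]
    by (auto intro: finite_subset)
  have inj: "inj_on (\<lambda>x. (restrict x J, restrict x I)) (cube n)"
  proof (rule inj_onI)
    fix x y assume xy: "x \<in> cube n" "y \<in> cube n"
      and eq: "(restrict x J, restrict x I) = (restrict y J, restrict y I)"
    show "x = y"
    proof (rule PiE_ext)
      show "x \<in> bit_cube {1..n}" "y \<in> bit_cube {1..n}" using xy by (auto simp: cube_eq)
      fix j assume "j \<in> {1..n}"
      then have "j \<in> I \<or> j \<in> J" using IJ by auto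
      then show "x j = y j" using eq by (auto simp: restrict_def fun_eq_iff split: if_splits)
    qed
  qed
  have "card A \<le> card (K \<times> bit_cube I)"
  proof (rule card_inj_on_le[OF inj_on_subset[OF inj]])
    show "A \<subseteq> cube n" by (auto simp: A_def)
    show "(\<lambda>x. (restrict x J, restrict x I)) ` A \<subseteq> K \<times> bit_cube I"
      using restr(1) unfolding A_def by blast
    show "finite (K \<times> bit_cube I)"
      using fin(1) finite_bit_cube[OF IJ(3)] by (rule finite_cartesian_product)
  qed
  moreover have "card B \<le> card (S \<times> D)"
    by (rule card_inj_on_le[OF inj_on_subset[OF inj]]) (use fin in \<open>auto simp: B_def\<close>)
  moreover have "card (bit_cube I) = 2 ^ m" using card_bit_cube[OF IJ(3)] by (simp add: I_def)
  ultimately have card: "card (A \<union> B) \<le> card K * 2 ^ m + card S * card D"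
    using card_Un_le[of A B] by (simp add: card_cartesian_product)
  define merge where "merge v u = (\<lambda>j::nat. if j \<le> m then v j else u j :: nat)" for v u
  have mergeI: "j \<in> I \<Longrightarrow> merge v u j = v j" and mergeJ: "j \<in> J \<Longrightarrow> merge v u j = u j" for j v u
    by (auto simp: merge_def I_def J)
  have merge_cube: "merge v u \<in> cube n"
    if "v \<in> cube n \<or> v \<in> bit_cube I" "u \<in> cube n \<or> u \<in> bit_cube J" for v u
    using that mn by (auto simp: merge_def cube_eq PiE_iff extensional_def I_def J)
  have bw: "below_within {1..n} (a + b) x y"
    if "below_within I a x y" "below_within J b x y" for a b x y
    using below_within_Un[OF that IJ(3,4)] IJ(1) by simp
  have low: "\<exists>w\<in>A \<union> B. (\<forall>j\<in>I. w j = x j) \<and> below_within {1..n} R x w"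
    and raised: "x i = 0 \<Longrightarrow> \<exists>w\<in>A \<union> B. w i = 1 \<and> below_within {1..n} (R + 1) x w"
    if x: "x \<in> cube n" and xS: "restrict x J \<notin> S" for x
  proof -
    obtain y where y: "y \<in> K" "below_within J R (restrict x J) y"
      using xS restr(2)[OF x] S by auto
    have yJ: "y \<in> bit_cube J" using y(1) K by blast
    define w where "w = merge x y"
    have w: "w \<in> cube n" unfolding w_def using merge_cube x yJ by auto
    have wJ: "restrict w J = y"
      unfolding w_def using yJ by (auto simp: mergeJ PiE_iff extensional_def)
    have wI: "\<forall>j\<in>I. w j = x j" by (simp add: w_def mergeI)
    have "below_within I 0 x w"
      by (rule below_within_cong[OF below_within_refl[of I 0 x]]) (auto simp: wI)
    moreover have "below_within J R x w"
      by (rule below_within_cong[OF y(2)]) (auto simp: w_def mergeJ)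
    ultimately have bww: "below_within {1..n} R x w" using bw[of 0 x w R] by simp
    show "\<exists>w\<in>A \<union> B. (\<forall>j\<in>I. w j = x j) \<and> below_within {1..n} R x w"
      using w wJ wI bww y(1) by (auto simp: A_def)
    assume x0: "x i = 0"
    have in1: "i \<in> {1..n}" using i IJ by auto
    have "restrict (w(i := 1)) J = restrict w J"
      using i IJ(2) by (intro restrict_ext) auto
    then have "w(i := 1) \<in> A" using cube_upd[OF w in1] wJ y(1) by (simp add: A_def)
    then show "\<exists>w\<in>A \<union> B. w i = 1 \<and> below_within {1..n} (R + 1) x w"
      using below_within_raise[OF bww in1 x0] by (intro bexI[of _ "w(i := 1)"]) auto
  qed
  have lift: "\<exists>w\<in>A \<union> B. w i = c \<and> below_within {1..n} a x w"
    if x: "x \<in> cube n" and xS: "restrict x J \<in> S"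
      and z: "z \<in> D" "z i = c" "below_within I a (restrict x I) z" for x z a c
  proof -
    have zI: "z \<in> bit_cube I" using z(1) DI by blast
    define w where "w = merge z x"
    have w: "w \<in> cube n" unfolding w_def using merge_cube x zI by auto
    have "restrict w J = restrict x J"
      unfolding w_def by (auto simp: mergeJ restrict_def)
    moreover have "restrict w I = z"
      unfolding w_def using zI by (auto simp: mergeI PiE_iff extensional_def)
    ultimately have wB: "w \<in> B" using w xS z by (simp add: B_def)
    have "below_within J 0 x w"
      by (rule below_within_cong[OF below_within_refl[of J 0 x]]) (auto simp: w_def mergeJ)
    moreover have "below_within I a x w"
      by (rule below_within_cong[OF z(3)]) (auto simp: w_def mergeI)
    ultimately have "below_within {1..n} a x w" using bw[of a x w 0] by simp
    then show ?thesis using wB i z(2) by (auto simp: w_def mergeI intro!: bexI[of _ w])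
  qed
  have "normal_at n R (A \<union> B) i"
    unfolding normal_at_def
  proof (intro conjI ballI impI)
    show "A \<union> B \<subseteq> cube n" by (auto simp: A_def B_def)
    show "i \<in> {1..n}" using i IJ by auto
    fix x assume x: "x \<in> cube n"
    have xI: "restrict x I \<in> cube m" using restr(1)[OF x] by (simp add: cube_eq I_def)
    have xi: "restrict x I i = x i" using i by simp
    {
      assume x0: "x i = 0"
      show "\<exists>a b. a + b \<le> 2 * R + 1 \<and>
            (\<exists>y\<in>A \<union> B. y i = 0 \<and> below_within {1..n} a x y) \<and>
            (\<exists>y\<in>A \<union> B. y i = 1 \<and> below_within {1..n} b x y)"
      proof (cases "restrict x J \<in> S")
        case True
        from D xI xi x0 obtain a b y z where ab: "a + b \<le> 2 * R + 1"
          and y: "y \<in> D" "y i = 0" "below_within I a (restrict x I) y"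
          and z: "z \<in> D" "z i = 1" "below_within I b (restrict x I) z"
          unfolding normal_at_def I_def by metis
        show ?thesis using ab lift[OF x True y] lift[OF x True z] by blast
      next
        case False
        obtain w where "w \<in> A \<union> B" "w i = 0" "below_within {1..n} R x w"
          using low[OF x False] x0 i by metis
        then show ?thesis using raised[OF x False x0]
          by - (rule exI[of _ R], rule exI[of _ "R + 1"], auto)
      qed
    }
    assume x1: "x i = 1"
    show "\<exists>y\<in>A \<union> B. y i = 1 \<and> below_within {1..n} R x y"
    proof (cases "restrict x J \<in> S")
      case True
      from D xI xi x1 obtain y where
        y: "y \<in> D" "y i = 1" "below_within I R (restrict x I) y"
        unfolding normal_at_def I_def by metis
      show ?thesis using lift[OF x True y] .
    next
      case False
      then show ?thesis using low[OF x False] x1 i by metis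
    qed
  qed
  then show thesis using card that by blast
qed

definition min_size :: "nat \<Rightarrow> nat \<Rightarrow> nat" where
  "min_size R n = (LEAST s. \<exists>C i. normal_at n R C i \<and> card C = s)"

lemma min_size_attained:
  assumes "n \<ge> 1"
  obtains C i where "normal_at n R C i" "card C = min_size R n"
proof -
  have "\<exists>s C i. normal_at n R C i \<and> card C = s" using normal_at_cube[OF assms] by blast
  then have "\<exists>C i. normal_at n R C i \<and> card C = min_size R n"
    unfolding min_size_def by (rule LeastI_ex)
  then show thesis using that by blast
qed

lemma min_size_le: "normal_at n R C i \<Longrightarrow> min_size R n \<le> card C"
  unfolding min_size_def by (rule Least_le) blast

text \<open>
  The threshold \<open>k\<close> separates the typical points over \<open>J\<close>, those with at least \<open>k\<close> zeros, from the
  others. The set \<open>S\<close> of uncovered points consists of a fraction of at most \<open>exp (- x)\<close> left over by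
  the greedy cover of the typical points, and of atypical points bounded by Chebyshev's inequality.
\<close>

lemma min_size_rec:
  assumes m: "m \<ge> 1" "m \<le> n" and N: "N = n - m" and k: "2 * k < N" and x: "x \<ge> 0"
  shows "real (min_size R n) \<le> (x * 2 ^ N / real (binomial_upto k R) + 1) * 2 ^ m
    + 2 ^ N * (exp (- x) + real N / (real N - 2 * real k)\<^sup>2) * real (min_size R m)"
proof -
  define J where "J = {m+1..n}"
  have J: "finite J" "card J = N" using N by (auto simp: J_def)
  define b where "b = binomial_upto k R"
  have b: "real b > 0" using binomial_upto_pos[of k R] by (simp add: b_def)
  define T where "T = {u\<in>bit_cube J. k \<le> card {j\<in>J. u j = 0}}"
  define T' where "T' = {u\<in>bit_cube J. card {j\<in>J. u j = 0} < k}"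
  define M where "M = nat \<lceil>x * 2 ^ N / real b\<rceil>"
  have fY: "finite (bit_cube J)" using finite_bit_cube[OF J(1)] .
  have cY: "card (bit_cube J) = 2 ^ N" using card_bit_cube[OF J(1)] J by simp
  have "\<exists>K\<subseteq>bit_cube J. card K \<le> M \<and> real (card {u\<in>T. \<forall>y\<in>K. \<not> below_within J R u y})
      \<le> exp (- (real M * real b / real (card (bit_cube J)))) * real (card T)"
  proof (rule exists_partial_cover)
    show "finite T" using fY by (simp add: T_def)
    show "bit_cube J \<noteq> {}" using cY by auto
    show "b \<le> card {y\<in>bit_cube J. below_within J R u y}" if "u \<in> T" for u
      using that card_points_above[OF J(1), of u R]
        binomial_upto_mono[of k "card {j\<in>J. u j = 0}" R]
      by (simp add: T_def b_def)
  qed (rule fY)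
  then obtain K where K: "K \<subseteq> bit_cube J" "card K \<le> M" and
    KT: "real (card {u\<in>T. \<forall>y\<in>K. \<not> below_within J R u y})
      \<le> exp (- (real M * real b / 2 ^ N)) * real (card T)"
    unfolding cY by auto
  have Mx: "x * 2 ^ N / real b \<le> real M" "real M \<le> x * 2 ^ N / real b + 1"
    unfolding M_def using x b by (auto simp: real_nat_ceiling_ge intro: order.trans)
  have "x \<le> real M * real b / 2 ^ N"
    using Mx(1) b by (simp add: field_simps)
  moreover have "card T \<le> 2 ^ N"
    unfolding cY[symmetric] by (rule card_mono[OF fY]) (auto simp: T_def)
  then have "real (card T) \<le> 2 ^ N" by (metis of_nat_le_iff of_nat_numeral of_nat_power)
  ultimately have "exp (- (real M * real b / 2 ^ N)) * real (card T) \<le> exp (- x) * 2 ^ N"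
    by (intro mult_mono) auto
  with KT have KT': "real (card {u\<in>T. \<forall>y\<in>K. \<not> below_within J R u y}) \<le> exp (- x) * 2 ^ N"
    by linarith
  define S where "S = {u\<in>bit_cube J. \<forall>y\<in>K. \<not> below_within J R u y}"
  have "S \<subseteq> {u\<in>T. \<forall>y\<in>K. \<not> below_within J R u y} \<union> T'"
    by (auto simp: S_def T_def T'_def)
  then have "card S \<le> card ({u\<in>T. \<forall>y\<in>K. \<not> below_within J R u y} \<union> T')"
    by (rule card_mono[rotated]) (use fY in \<open>auto simp: T_def T'_def\<close>)
  also have "\<dots> \<le> card {u\<in>T. \<forall>y\<in>K. \<not> below_within J R u y} + card T'"
    by (rule card_Un_le)
  finally have "real (card S) \<le> real (card {u\<in>T. \<forall>y\<in>K. \<not> below_within J R u y}) + real (card T')"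
    by linarith
  moreover have "real (card T') \<le> 2 ^ N * (real N / (real N - 2 * real k)\<^sup>2)"
    using card_few_zeros[OF J(1), of k] k by (simp add: J(2) T'_def)
  ultimately have S_le:
    "real (card S) \<le> 2 ^ N * (exp (- x) + real N / (real N - 2 * real k)\<^sup>2)"
    using KT' by (simp add: distrib_left mult.commute)
  obtain D i where D: "normal_at m R D i" "card D = min_size R m"
    using min_size_attained[OF m(1)] .
  obtain C where C: "normal_at n R C i" "card C \<le> card K * 2 ^ m + card S * card D"
    using normal_at_amalgam[OF D(1) m(2) J_def K(1) S_def] .
  have "min_size R n \<le> card K * 2 ^ m + card S * card D"
    using min_size_le[OF C(1)] C(2) by simp
  then have "real (min_size R n) \<le> real (card K * 2 ^ m + card S * card D)"
    by (simp only: of_nat_le_iff)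
  also have "\<dots> = real (card K) * 2 ^ m + real (card S) * real (min_size R m)"
    using D(2) by simp
  also have "\<dots> \<le> (x * 2 ^ N / real b + 1) * 2 ^ m
      + 2 ^ N * (exp (- x) + real N / (real N - 2 * real k)\<^sup>2) * real (min_size R m)"
  proof (intro add_mono mult_right_mono)
    show "real (card K) \<le> x * 2 ^ N / real b + 1" using K(2) Mx(2) by linarith
  qed (use S_le in auto)
  finally show ?thesis by (simp add: b_def)
qed

definition min_density :: "nat \<Rightarrow> nat \<Rightarrow> real" where
  "min_density R n = real (min_size R n) * real (binomial_upto (n div 2) R) / 2 ^ n"

lemma min_density_rec:
  assumes m: "m \<ge> 1" "m \<le> n" and N: "N = n - m" and k: "2 * k < N" and x: "x \<ge> 0"
  shows "min_density R n \<le>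
    x * (real (binomial_upto (n div 2) R) / real (binomial_upto k R))
      + real (binomial_upto (n div 2) R) / 2 ^ N
    + (exp (- x) + real N / (real N - 2 * real k)\<^sup>2)
      * (real (binomial_upto (n div 2) R) / real (binomial_upto (m div 2) R))
      * min_density R m"
proof -
  have n: "n = N + m" using N m by simp
  define E where "E = exp (- x) + real N / (real N - 2 * real k)\<^sup>2"
  define \<beta> where "\<beta> = real (binomial_upto (n div 2) R)"
  define \<gamma> where "\<gamma> = real (binomial_upto (m div 2) R)"
  define \<delta> where "\<delta> = real (binomial_upto k R)"
  have pos: "\<beta> > 0" "\<gamma> > 0" "\<delta> > 0"
    using binomial_upto_pos[of "n div 2" R] binomial_upto_pos[of "m div 2" R]
      binomial_upto_pos[of k R] by (auto simp: \<beta>_def \<gamma>_def \<delta>_def)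
  have "min_density R n = real (min_size R n) * (\<beta> / 2 ^ n)"
    by (simp add: min_density_def \<beta>_def)
  also have "\<dots> \<le> ((x * 2 ^ N / \<delta> + 1) * 2 ^ m + 2 ^ N * E * real (min_size R m)) * (\<beta> / 2 ^ n)"
    using min_size_rec[OF m N k x, of R] pos
    by (intro mult_right_mono) (auto simp: E_def \<delta>_def)
  also have "\<dots> = x * (\<beta> / \<delta>) + \<beta> / 2 ^ N + E * (\<beta> / \<gamma>) * min_density R m"
    using pos unfolding min_density_def \<gamma>_def[symmetric] n
    by (simp add: power_add field_simps)
  finally show ?thesis by (simp add: \<beta>_def \<gamma>_def \<delta>_def E_def)
qed

section \<open>Growth of binomial sums\<close>

lemma binomial_over_power_tendsto:
  "(\<lambda>k. real (k choose i) / real k ^ i) \<longlonglongrightarrow> 1 / fact i"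
proof (induction i)
  case 0
  show ?case by simp
next
  case (Suc i)
  have "(\<lambda>k. real (k choose i) / real k ^ i * ((real k - real i) / real k / (1 + real i)))
      \<longlonglongrightarrow> 1 / fact i * (1 / (1 + real i))"
    by (intro tendsto_mult Suc.IH tendsto_divide tendsto_const) (real_asymp, simp)
  moreover have "\<forall>\<^sub>F k in sequentially.
      real (k choose i) / real k ^ i * ((real k - real i) / real k / (1 + real i))
      = real (k choose Suc i) / real k ^ Suc i"
    using eventually_ge_at_top[of "i + 1"]
  proof eventually_elim
    case (elim k)
    have "Suc i * (k choose Suc i) = (k - i) * (k choose i)"
      using elim by (metis binomial_absorb_comp binomial_absorption mult.commute)
    then have "(1 + real i) * real (k choose Suc i) = (real k - real i) * real (k choose i)"
      using elim by (metis Suc_eq_plus1 add.commute add_leD1 of_nat_Suc of_nat_diff of_nat_mult)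
    then have "real (k choose Suc i) = (real k - real i) * real (k choose i) / (1 + real i)"
      by (simp add: field_simps)
    then show ?case by (simp add: mult_ac)
  qed
  ultimately have "(\<lambda>k. real (k choose Suc i) / real k ^ Suc i)
      \<longlonglongrightarrow> 1 / fact i * (1 / (1 + real i))"
    by (rule Lim_transform_eventually)
  then show ?case by (simp add: field_simps)
qed

lemma binomial_upto_over_power_tendsto:
  "(\<lambda>k. real (binomial_upto k R) / real k ^ R) \<longlonglongrightarrow> 1 / fact R"
proof -
  have low: "(\<lambda>k. real (k choose i) / real k ^ R) \<longlonglongrightarrow> 0" if "i < R" for i
  proof -
    have "(\<lambda>k. 1 / real k ^ (R - i)) \<longlonglongrightarrow> 0"
      using that by real_asymp
    then have "(\<lambda>k. real (k choose i) / real k ^ i * (1 / real k ^ (R - i)))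
        \<longlonglongrightarrow> 1 / fact i * 0"
      by (intro tendsto_mult binomial_over_power_tendsto)
    then show ?thesis using that by (simp add: power_add[symmetric])
  qed
  have "(\<lambda>k. (\<Sum>i<R. real (k choose i) / real k ^ R) + real (k choose R) / real k ^ R)
      \<longlonglongrightarrow> (\<Sum>i<R. 0) + 1 / fact R"
    by (intro tendsto_add tendsto_sum binomial_over_power_tendsto low) auto
  moreover have "(\<lambda>k. real (binomial_upto k R) / real k ^ R)
      = (\<lambda>k. (\<Sum>i<R. real (k choose i) / real k ^ R) + real (k choose R) / real k ^ R)"
    by (simp add: binomial_upto_def lessThan_Suc_atMost[symmetric] sum_divide_distrib
        add_divide_distrib)
  ultimately show ?thesis by simp
qed

text \<open>
  All binomial sums in the recursion have a lower index close to a multiple of \<open>n\<close>, and only that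
  multiple survives in the limit.
\<close>

lemma binomial_upto_linear_tendsto:
  fixes a :: "nat \<Rightarrow> nat"
  assumes a: "(\<lambda>n. real (a n) / real n) \<longlonglongrightarrow> \<alpha>" and \<alpha>: "\<alpha> > 0"
  shows "(\<lambda>n. real (binomial_upto (a n) R) / real n ^ R) \<longlonglongrightarrow> \<alpha> ^ R / fact R"
proof -
  have "filterlim (\<lambda>n. real (a n) / real n * real n) at_top sequentially"
    by (rule filterlim_tendsto_pos_mult_at_top[OF a \<alpha> filterlim_real_sequentially])
  moreover have "\<forall>\<^sub>F n in sequentially. real (a n) / real n * real n = real (a n)"
    using eventually_gt_at_top[of 0] by eventually_elim simp
  ultimately have "filterlim (\<lambda>n. real (a n)) at_top sequentially"
    by (subst (asm) filterlim_cong[OF refl refl]) auto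
  then have a_top: "filterlim a at_top sequentially"
    by (simp add: filterlim_sequentially_iff_filterlim_real)
  have "(\<lambda>n. real (binomial_upto (a n) R) / real (a n) ^ R * (real (a n) / real n) ^ R)
      \<longlonglongrightarrow> 1 / fact R * \<alpha> ^ R"
    by (intro tendsto_mult tendsto_power a
        filterlim_compose[OF binomial_upto_over_power_tendsto a_top])
  moreover have "\<forall>\<^sub>F n in sequentially.
      real (binomial_upto (a n) R) / real (a n) ^ R * (real (a n) / real n) ^ R
      = real (binomial_upto (a n) R) / real n ^ R"
    using eventually_compose_filterlim[OF eventually_gt_at_top[of 0] a_top]
    by eventually_elim (simp add: power_divide)
  ultimately show ?thesis by (auto dest: Lim_transform_eventually)
qed

lemma binomial_upto_ratio_tendsto:
  fixes a c :: "nat \<Rightarrow> nat"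
  assumes "(\<lambda>n. real (a n) / real n) \<longlonglongrightarrow> \<alpha>" "\<alpha> > 0"
    and "(\<lambda>n. real (c n) / real n) \<longlonglongrightarrow> \<gamma>" "\<gamma> > 0"
  shows "(\<lambda>n. real (binomial_upto (a n) R) / real (binomial_upto (c n) R))
    \<longlonglongrightarrow> (\<alpha> / \<gamma>) ^ R"
proof -
  have "(\<lambda>n. (real (binomial_upto (a n) R) / real n ^ R)
        / (real (binomial_upto (c n) R) / real n ^ R))
      \<longlonglongrightarrow> (\<alpha> ^ R / fact R) / (\<gamma> ^ R / fact R)"
    by (intro tendsto_divide binomial_upto_linear_tendsto assms) (use assms in auto)
  moreover have "\<forall>\<^sub>F n in sequentially. (real (binomial_upto (a n) R) / real n ^ R)
        / (real (binomial_upto (c n) R) / real n ^ R)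
      = real (binomial_upto (a n) R) / real (binomial_upto (c n) R)"
    using eventually_gt_at_top[of 0] by eventually_elim simp
  ultimately have "(\<lambda>n. real (binomial_upto (a n) R) / real (binomial_upto (c n) R))
      \<longlonglongrightarrow> (\<alpha> ^ R / fact R) / (\<gamma> ^ R / fact R)"
    by (rule Lim_transform_eventually)
  then show ?thesis by (simp add: power_divide)
qed

lemma div_over_tendsto:
  assumes "c > 0"
  shows "(\<lambda>n. real (n div c) / real n) \<longlonglongrightarrow> 1 / real c"
proof (rule tendsto_sandwich)
  show "(\<lambda>n. 1 / real c - 1 / real n) \<longlonglongrightarrow> 1 / real c"
    by real_asymp
  show "\<forall>\<^sub>F n in sequentially. 1 / real c - 1 / real n \<le> real (n div c) / real n"
    using eventually_gt_at_top[of 0]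
  proof eventually_elim
    case (elim n)
    have "real n / real c - 1 \<le> real (n div c)"
      using floor_divide_of_nat_eq[of n c, where 'a = real] by linarith
    then have "(real n / real c - 1) / real n \<le> real (n div c) / real n"
      using elim by (simp add: divide_right_mono)
    then show ?case using elim by (simp add: diff_divide_distrib)
  qed
  show "\<forall>\<^sub>F n in sequentially. real (n div c) / real n \<le> 1 / real c"
    using eventually_gt_at_top[of 0]
  proof eventually_elim
    case (elim n)
    have "real (n div c) \<le> real n / real c"
      using floor_divide_of_nat_eq[of n c, where 'a = real] by linarith
    then have "real (n div c) / real n \<le> real n / real c / real n"
      by (rule divide_right_mono) simp
    then show ?case using elim by simp
  qed
qed auto

section \<open>The recursive inequality\<close>

text \<open>
  The deviation \<open>N powr (3/4)\<close> from \<open>N / 2\<close> is of smaller order than \<open>N\<close>, so the binomial sums keep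
  their limits, and of larger order than the standard deviation, so the atypical points are negligible.
  Any exponent strictly between \<open>1/2\<close> and \<open>1\<close> has both properties.
\<close>

definition typical_zeros :: "nat \<Rightarrow> nat" where
  "typical_zeros N = nat \<lfloor>real N / 2 - real N powr (3/4)\<rfloor>"

lemma typical_zeros_over_tendsto: "(\<lambda>N. real (typical_zeros N) / real N) \<longlonglongrightarrow> 1 / 2"
proof (rule tendsto_sandwich)
  show "(\<lambda>N. (real N / 2 - real N powr (3/4) - 1) / real N) \<longlonglongrightarrow> 1 / 2"
    by real_asymp
  show "\<forall>\<^sub>F N in sequentially.
      (real N / 2 - real N powr (3/4) - 1) / real N \<le> real (typical_zeros N) / real N"
    by (intro always_eventually allI divide_right_mono)
      (simp_all add: typical_zeros_def, linarith)
  have "\<forall>\<^sub>F N in sequentially. real N / 2 - real N powr (3/4) \<ge> 0"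
    by real_asymp
  then show "\<forall>\<^sub>F N in sequentially. real (typical_zeros N) / real N \<le> 1 / 2"
  proof eventually_elim
    case (elim N)
    have "real (typical_zeros N) \<le> real N / 2 - real N powr (3/4)"
      using elim by (simp add: typical_zeros_def)
    also have "\<dots> \<le> real N / 2" by simp
    finally have "real (typical_zeros N) / real N \<le> real N / 2 / real N"
      by (intro divide_right_mono) auto
    then show ?case by (cases "N = 0") auto
  qed
qed auto

lemma typical_zeros_deviation:
  "\<forall>\<^sub>F N in sequentially. 2 * typical_zeros N < N"
  "(\<lambda>N. real N / (real N - 2 * real (typical_zeros N))\<^sup>2) \<longlonglongrightarrow> 0"
proof -
  have dev: "\<forall>\<^sub>F N in sequentially. 2 * real N powr (3/4) \<le> real N - 2 * real (typical_zeros N)"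
  proof -
    have "\<forall>\<^sub>F N in sequentially. real N / 2 - real N powr (3/4) \<ge> 0"
      by real_asymp
    then show ?thesis
    proof eventually_elim
      case (elim N)
      have "real (typical_zeros N) \<le> real N / 2 - real N powr (3/4)"
        using elim by (simp add: typical_zeros_def)
      then show ?case by simp
    qed
  qed
  show "\<forall>\<^sub>F N in sequentially. 2 * typical_zeros N < N"
    using dev eventually_gt_at_top[of 0]
  proof eventually_elim
    case (elim N)
    have "2 * real N powr (3/4) > 0" using elim by simp
    then have "2 * real (typical_zeros N) < real N" using elim by linarith
    then show ?case by linarith
  qed
  show "(\<lambda>N. real N / (real N - 2 * real (typical_zeros N))\<^sup>2) \<longlonglongrightarrow> 0"
  proof (rule tendsto_sandwich[OF _ _ tendsto_const])
    show "\<forall>\<^sub>F N in sequentially. real N / (real N - 2 * real (typical_zeros N))\<^sup>2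
        \<le> real N / (2 * real N powr (3/4))\<^sup>2"
      using dev eventually_gt_at_top[of 0]
      by eventually_elim (intro divide_left_mono power_mono mult_pos_pos, auto)
    show "(\<lambda>N. real N / (2 * real N powr (3/4))\<^sup>2) \<longlonglongrightarrow> 0"
      by real_asymp
  qed auto
qed

text \<open>
  With \<open>l = a / (1 - c)\<close>, the fixed point of \<open>\<lambda>y. a + c * y\<close>, strong induction gives a bound \<open>l + B\<close>
  valid for all \<open>n\<close>. Since \<open>m n\<close> tends to infinity, every further use of the recursion multiplies the
  excess over \<open>l\<close> by \<open>c\<close>.
\<close>

lemma eventually_le_of_contraction:
  fixes f :: "nat \<Rightarrow> real" and m :: "nat \<Rightarrow> nat"
  assumes f: "\<And>n. f n \<ge> 0" and c: "0 \<le> c" "c < 1" and a: "a \<ge> 0"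
    and m_less: "\<And>n. n > 0 \<Longrightarrow> m n < n"
    and m_top: "filterlim m at_top sequentially"
    and rec: "\<forall>\<^sub>F n in sequentially. f n \<le> a + c * f (m n)"
    and t: "t > a / (1 - c)"
  shows "\<forall>\<^sub>F n in sequentially. f n \<le> t"
proof -
  define l where "l = a / (1 - c)"
  have l: "a + c * l = l" using c by (simp add: l_def field_simps)
  have l0: "l \<ge> 0" using a c by (simp add: l_def)
  obtain n0 where n0: "\<And>n. n \<ge> n0 \<Longrightarrow> f n \<le> a + c * f (m n)"
    using rec by (auto simp: eventually_sequentially)
  define B where "B = (\<Sum>n\<le>n0. f n)"
  have B0: "B \<ge> 0" unfolding B_def by (intro sum_nonneg f)
  \<comment> \<open>The sum \<open>B\<close> dominates the finitely many values for which the recursion may fail.\<close>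
  have bounded: "f n \<le> l + B" for n
  proof (induction n rule: less_induct)
    case (less n)
    show ?case
    proof (cases "n \<le> n0")
      case True
      have "f n \<le> B" unfolding B_def by (rule member_le_sum) (use True f in auto)
      then show ?thesis using l0 by simp
    next
      case False
      have "f n \<le> a + c * f (m n)" using n0 False by simp
      also have "\<dots> \<le> a + c * (l + B)"
        using less.IH[OF m_less] False c by (intro add_left_mono mult_left_mono) auto
      also have "\<dots> = l + c * B" using l by (simp add: algebra_simps)
      also have "\<dots> \<le> l + B" using c B0 mult_right_mono[of c 1 B] by simp
      finally show ?thesis .
    qed
  qed
  have iter: "\<forall>\<^sub>F n in sequentially. f n \<le> l + c ^ j * B" for j
  proof (induction j)
    case 0
    show ?case using bounded by simp
  next
    case (Suc j)
    have "\<forall>\<^sub>F n in sequentially. f (m n) \<le> l + c ^ j * B"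
      using m_top Suc.IH by (rule eventually_compose_filterlim[rotated])
    then show ?case using rec
    proof eventually_elim
      case (elim n)
      have "f n \<le> a + c * (l + c ^ j * B)"
        using elim c mult_left_mono[of "f (m n)" "l + c ^ j * B" c] by linarith
      also have "\<dots> = l + c ^ Suc j * B" using l by (simp add: algebra_simps)
      finally show ?case .
    qed
  qed
  have "(\<lambda>j. l + c ^ j * B) \<longlonglongrightarrow> l + 0 * B"
    by (intro tendsto_intros LIMSEQ_realpow_zero c)
  then have "\<forall>\<^sub>F j in sequentially. l + c ^ j * B < t"
    using t by (auto simp: l_def dest: order_tendstoD(2))
  then obtain j where j: "l + c ^ j * B < t"
    by (auto simp: eventually_sequentially)
  show ?thesis using iter[of j] by eventually_elim (use j in linarith)
qed

lemma one_plus_inverse_power_less_exp: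
  assumes "R \<ge> 1"
  shows "(1 + 1 / real R) ^ R < exp 1"
proof -
  have "ln (1 + 1 / real R) < 1 / real R"
    using assms by (intro ln_add_one_self_less_self) auto
  then have "real R * ln (1 + 1 / real R) < 1"
    using assms by (simp add: field_simps)
  then have "exp (real R * ln (1 + 1 / real R)) < exp 1" by simp
  moreover have "exp (real R * ln (1 + 1 / real R)) = (1 + 1 / real R) ^ R"
    by (simp add: exp_of_nat_mult add_pos_nonneg)
  ultimately show ?thesis by simp
qed

text \<open>
  The coefficients of \<open>min_density_rec\<close> tend to \<open>x (1 + 1/R)^R\<close> and \<open>exp (- x) (R + 1)^R\<close>. Because
  \<open>(1 + 1/R)^R\<close> is strictly less than \<open>e\<close>, the errors are eventually absorbed by replacing it with \<open>e\<close>.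
\<close>

lemma min_density_eventually_rec:
  assumes R: "R \<ge> 1" and x: "x > 0"
  shows "\<forall>\<^sub>F n in sequentially. min_density R n
    \<le> exp 1 * x + exp (1 - x) * real R ^ R * min_density R (n div (R + 1))"
proof -
  define m where "m n = n div (R + 1)" for n
  define N where "N n = n - m n" for n
  define k where "k n = typical_zeros (N n)" for n
  define \<beta> where "\<beta> n = real (binomial_upto (n div 2) R)" for n
  define P where "P n = x * (\<beta> n / real (binomial_upto (k n) R)) + \<beta> n / 2 ^ N n" for n
  define Q where "Q n = (exp (- x) + real (N n) / (real (N n) - 2 * real (k n))\<^sup>2)
      * (\<beta> n / real (binomial_upto (m n div 2) R))" for n
  have m_lim: "(\<lambda>n. real (m n) / real n) \<longlonglongrightarrow> 1 / real (R + 1)"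
    unfolding m_def by (rule div_over_tendsto) simp
  have m_le: "m n \<le> n" for n by (simp add: m_def)
  have "(\<lambda>n. 1 - real (m n) / real n) \<longlonglongrightarrow> 1 - 1 / real (R + 1)"
    by (intro tendsto_intros m_lim)
  moreover have "\<forall>\<^sub>F n in sequentially. 1 - real (m n) / real n = real (N n) / real n"
    using eventually_gt_at_top[of 0]
    by eventually_elim (use m_le in \<open>simp add: N_def of_nat_diff diff_divide_distrib\<close>)
  moreover have "1 - 1 / real (R + 1) = real R / real (R + 1)" by (simp add: field_simps)
  ultimately have N_lim: "(\<lambda>n. real (N n) / real n) \<longlonglongrightarrow> real R / real (R + 1)"
    by (auto dest: Lim_transform_eventually)
  have N_ge: "n div 2 \<le> N n" for n
  proof -
    have "n div (R + 1) \<le> n div 2" using R by (intro div_le_mono2) auto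
    then show ?thesis unfolding N_def m_def by linarith
  qed
  have half_top: "filterlim (\<lambda>n::nat. n div 2) at_top sequentially"
    by (rule filterlim_at_top_div_const_nat) simp
  have N_top: "filterlim N at_top sequentially"
    by (rule filterlim_at_top_mono[OF half_top]) (simp add: N_ge)
  have "(\<lambda>n. real (k n) / real (N n) * (real (N n) / real n))
      \<longlonglongrightarrow> 1 / 2 * (real R / real (R + 1))"
    unfolding k_def
    by (intro tendsto_mult N_lim filterlim_compose[OF typical_zeros_over_tendsto N_top])
  moreover have "\<forall>\<^sub>F n in sequentially. real (k n) / real (N n) * (real (N n) / real n)
      = real (k n) / real n"
    using eventually_compose_filterlim[OF eventually_gt_at_top[of 0] N_top]
    by eventually_elim simp
  ultimately have k_lim: "(\<lambda>n. real (k n) / real n) \<longlonglongrightarrow> 1 / 2 * (real R / real (R + 1))"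
    by (rule Lim_transform_eventually)
  have half_lim: "(\<lambda>n. real (n div 2) / real n) \<longlonglongrightarrow> 1 / 2"
    using div_over_tendsto[of 2] by simp
  have m2_lim: "(\<lambda>n. real (m n div 2) / real n) \<longlonglongrightarrow> 1 / real ((R + 1) * 2)"
    unfolding m_def div_mult2_eq[symmetric] by (rule div_over_tendsto) simp
  have eq1: "(1 / 2) / (1 / 2 * (real R / real (R + 1))) = 1 + 1 / real R"
    using R by (simp add: field_simps)
  have eq2: "(1 / 2) / (1 / real ((R + 1) * 2)) = real R * (1 + 1 / real R)"
    using R by (simp add: field_simps)
  have small: "(\<lambda>n. \<beta> n / 2 ^ N n) \<longlonglongrightarrow> 0"
  proof -
    have "(\<lambda>n. real (n div 2) ^ R / 2 ^ (n div 2)) \<longlonglongrightarrow> 0"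
      by (rule filterlim_compose[OF _ half_top, of "\<lambda>n. real n ^ R / 2 ^ n"]) real_asymp
    then have "(\<lambda>n. \<beta> n / real (n div 2) ^ R * (real (n div 2) ^ R / 2 ^ (n div 2)))
        \<longlonglongrightarrow> 1 / fact R * 0"
      unfolding \<beta>_def
      by (intro tendsto_mult filterlim_compose[OF binomial_upto_over_power_tendsto half_top])
    then have lim: "(\<lambda>n. \<beta> n / real (n div 2) ^ R * (real (n div 2) ^ R / 2 ^ (n div 2)))
        \<longlonglongrightarrow> 0" by simp
    show ?thesis
    proof (rule tendsto_sandwich[OF _ _ tendsto_const lim])
      show "\<forall>\<^sub>F n in sequentially. \<beta> n / 2 ^ N n
          \<le> \<beta> n / real (n div 2) ^ R * (real (n div 2) ^ R / 2 ^ (n div 2))"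
        using eventually_ge_at_top[of 2]
      proof eventually_elim
        case (elim n)
        have "\<beta> n / 2 ^ N n \<le> \<beta> n / 2 ^ (n div 2)"
          using N_ge[of n] by (intro divide_left_mono power_increasing) (auto simp: \<beta>_def)
        then show ?case using elim by simp
      qed
    qed (simp add: \<beta>_def)
  qed
  have P_lim: "P \<longlonglongrightarrow> x * (1 + 1 / real R) ^ R + 0"
    unfolding P_def eq1[symmetric] using R
    by (intro tendsto_add tendsto_mult tendsto_const small,
        unfold \<beta>_def, intro binomial_upto_ratio_tendsto half_lim k_lim) auto
  have Q_lim: "Q \<longlonglongrightarrow> (exp (- x) + 0) * (real R * (1 + 1 / real R)) ^ R"
    unfolding Q_def eq2[symmetric] k_def using R
    by (intro tendsto_add tendsto_mult tendsto_const
        filterlim_compose[OF typical_zeros_deviation(2) N_top],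
        unfold \<beta>_def, intro binomial_upto_ratio_tendsto half_lim m2_lim) auto
  note e = one_plus_inverse_power_less_exp[OF R]
  have "x * (1 + 1 / real R) ^ R + 0 < exp 1 * x"
    using e x by simp
  then have P_le: "\<forall>\<^sub>F n in sequentially. P n < exp 1 * x"
    by (rule order_tendstoD(2)[OF P_lim])
  have "(exp (- x) + 0) * (real R * (1 + 1 / real R)) ^ R
      = exp (- x) * real R ^ R * (1 + 1 / real R) ^ R"
    by (simp only: power_mult_distrib add_0_right mult.assoc)
  also have "\<dots> < exp (- x) * real R ^ R * exp 1"
    using e R by (intro mult_strict_left_mono) auto
  also have "\<dots> = exp (1 - x) * real R ^ R"
    by (simp add: exp_diff exp_minus field_simps)
  finally have Q_le: "\<forall>\<^sub>F n in sequentially. Q n < exp (1 - x) * real R ^ R"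
    by (rule order_tendstoD(2)[OF Q_lim])
  have "\<forall>\<^sub>F n in sequentially. 2 * k n < N n"
    unfolding k_def using N_top typical_zeros_deviation(1)
    by (rule eventually_compose_filterlim[rotated])
  then show ?thesis using P_le Q_le eventually_ge_at_top[of "R + 1"]
  proof eventually_elim
    case (elim n)
    have m1: "m n \<ge> 1" using elim by (simp add: m_def Suc_le_eq div_greater_zero_iff)
    have "min_density R n \<le> P n + Q n * min_density R (m n)"
      using min_density_rec[OF m1 m_le N_def elim(1), of x R] x
      by (simp add: P_def Q_def \<beta>_def)
    also have "\<dots> \<le> exp 1 * x + exp (1 - x) * real R ^ R * min_density R (m n)"
      using elim by (intro add_mono mult_right_mono) (auto simp: min_density_def)
    finally show ?case by (simp add: m_def)
  qed
qed

text \<open>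
  The choice of \<open>x\<close> cancels \<open>R^R\<close> in the contraction factor and leaves \<open>c = 1 / (e R ln R)\<close>. The bound
  \<open>e x / (1 - c) < e (x + 2)\<close> then amounts to \<open>c (x + 2) < 2\<close>, that is, to
  \<open>x + 2 < 2 e R ln R\<close>. This is tightest for \<open>R = 2\<close>, where rough numerical bounds on \<open>e\<close> and \<open>ln 2\<close>
  still suffice.
\<close>

lemma min_density_eventually_le:
  assumes R: "R \<ge> 2"
  shows "\<forall>\<^sub>F n in sequentially. min_density R n
    \<le> exp 1 * (real R * ln (real R) + ln (real R) + ln (ln (real R)) + 4)"
proof -
  define L where "L = ln (real R)"
  define x where "x = real R * L + L + ln L + 2"
  define c where "c = exp (1 - x) * real R ^ R"
  have "exp (3 / 5 :: real) = exp (3 / 10) * exp (3 / 10)" by (simp flip: exp_add)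
  also have "\<dots> \<le> (139 / 100) * (139 / 100)"
    using exp_bound[of "3 / 10 :: real"] by (intro mult_mono) (auto simp: power2_eq_square)
  also have "\<dots> \<le> (2::real)" by simp
  finally have "3 / 5 \<le> ln (2::real)" by (subst ln_ge_iff) auto
  also have "\<dots> \<le> L" using R by (simp add: L_def)
  finally have L: "L \<ge> 3 / 5" .
  have RL: "real R * L \<ge> 6 / 5" using mult_mono[of 2 "real R" "3 / 5" L] R L by simp
  have lnL: "ln L \<le> L - 1" using L by (intro ln_le_minus_one) auto
  have x0: "x > 0"
  proof -
    have "ln (1 / L) \<le> 1 / L - 1" using L by (intro ln_le_minus_one) auto
    moreover have "ln (1 / L) = - ln L" using L by (simp add: ln_div)
    moreover have "1 / L \<le> 5 / 3" using L by (simp add: field_simps)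
    ultimately show ?thesis using RL L by (simp add: x_def)
  qed
  have c_eq: "c = 1 / (exp 1 * (real R * L))"
  proof -
    have "exp (1 - x) = exp (- 1) * (exp (- (real R * L)) * (exp (- L) * exp (- ln L)))"
      unfolding exp_add[symmetric] by (simp add: x_def algebra_simps)
    moreover have "exp (real R * L) = real R ^ R"
      using R by (simp add: L_def exp_of_nat_mult)
    moreover have "exp L = real R" using R by (simp add: L_def)
    moreover have "exp (ln L) = L" using L by simp
    ultimately show ?thesis using R L by (simp add: c_def exp_minus field_simps)
  qed
  have e: "exp (1::real) \<ge> 5 / 2"
    using exp_lower_Taylor_quadratic[of "1::real"] by simp
  have key: "x + 2 < 2 * (exp 1 * (real R * L))"
  proof -
    have "x + 2 \<le> real R * L + 2 * L + 3" using lnL by (simp add: x_def)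
    also have "\<dots> \<le> (9 / 2) * (real R * L)"
    proof -
      have "2 * L \<le> real R * L" using R L by (intro mult_right_mono) auto
      then show ?thesis using RL by linarith
    qed
    also have "\<dots> < 2 * (5 / 2 * (real R * L))" using RL by linarith
    also have "\<dots> \<le> 2 * (exp 1 * (real R * L))"
      using e RL by (intro mult_left_mono mult_right_mono) auto
    finally show ?thesis .
  qed
  have eRL: "exp 1 * (real R * L) > 1"
    using mult_mono[of "5 / 2" "exp 1" "6 / 5" "real R * L"] e RL by simp
  have c: "0 \<le> c" "c < 1" using eRL by (auto simp: c_eq)
  have "exp 1 * x / (1 - c) < exp 1 * (x + 2)"
  proof -
    have "c * (x + 2) < 2"
      using key eRL unfolding c_eq by (simp add: divide_less_eq)
    then have "x < (x + 2) * (1 - c)" by (simp add: algebra_simps)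
    then have "exp 1 * x < exp 1 * ((x + 2) * (1 - c))" by simp
    then show ?thesis using c by (simp add: divide_less_eq mult.assoc)
  qed
  moreover have "filterlim (\<lambda>n. n div (R + 1)) at_top sequentially"
    by (rule filterlim_at_top_div_const_nat) simp
  moreover have "\<forall>\<^sub>F n in sequentially. min_density R n
      \<le> exp 1 * x + c * min_density R (n div (R + 1))"
    using min_density_eventually_rec[of R x] R x0 by (simp add: c_def)
  ultimately have "\<forall>\<^sub>F n in sequentially. min_density R n \<le> exp 1 * (x + 2)"
    using c x0 R
    by (intro eventually_le_of_contraction[where f = "min_density R" and m = "\<lambda>n. n div (R + 1)"
          and c = c and a = "exp 1 * x"])
      (auto simp: min_density_def intro!: div_less_dividend)
  then show ?thesis by (simp add: x_def L_def add.assoc)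
qed

section \<open>From small norm to normal codes\<close>

lemma asym_dist_le_iff:
  "asym_dist n x Y \<le> enat r \<longleftrightarrow> (\<exists>y\<in>Y. below_within {1..n} r x y)"
proof -
  have "asym_dist n x Y \<le> enat r \<longleftrightarrow> (\<exists>y\<in>{y\<in>Y. cube_le n x y}. enat (hamming_dist n x y) \<le> enat r)"
  proof
    assume le: "asym_dist n x Y \<le> enat r"
    have "{y\<in>Y. cube_le n x y} \<noteq> {}"
    proof
      assume "{y\<in>Y. cube_le n x y} = {}"
      then have "asym_dist n x Y = Inf {}" by (simp only: asym_dist_def image_empty)
      then show False using le by (simp add: top_enat_def)
    qed
    then have "asym_dist n x Y \<in> (\<lambda>y. enat (hamming_dist n x y)) ` {y\<in>Y. cube_le n x y}"
      unfolding asym_dist_def by (metis (no_types, lifting) image_is_empty wellorder_InfI ex_in_conv)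
    then show "\<exists>y\<in>{y\<in>Y. cube_le n x y}. enat (hamming_dist n x y) \<le> enat r"
      using le by (auto simp del: enat_ord_simps)
  qed (auto simp: asym_dist_def intro: INF_lower2)
  then show ?thesis
    by (auto simp: below_within_def cube_le_def hamming_dist_def)
qed

lemma asym_norm_le_of_normal_at:
  assumes "normal_at n R C i"
  shows "asym_norm n C i \<le> enat (2 * R + 1)"
  unfolding asym_norm_def
proof (intro max.boundedI SUP_least)
  fix x assume "x \<in> slice (cube n) i 0"
  then have x: "x \<in> cube n" "x i = 0" by (auto simp: slice_def)
  obtain a b y z where ab: "a + b \<le> 2 * R + 1" and
    y: "y \<in> C" "y i = 0" "below_within {1..n} a x y" and
    z: "z \<in> C" "z i = 1" "below_within {1..n} b x z"
    using assms x unfolding normal_at_def by metis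
  have "asym_dist n x (slice C i 0) \<le> enat a" "asym_dist n x (slice C i 1) \<le> enat b"
    unfolding asym_dist_le_iff using y z by (auto simp: slice_def)
  then have "asym_dist n x (slice C i 0) + asym_dist n x (slice C i 1) \<le> enat a + enat b"
    by (rule add_mono)
  also have "\<dots> \<le> enat (2 * R + 1)" using ab by simp
  finally show "asym_dist n x (slice C i 0) + asym_dist n x (slice C i 1) \<le> enat (2 * R + 1)" .
next
  fix x assume "x \<in> slice (cube n) i 1"
  then have x: "x \<in> cube n" "x i = 1" by (auto simp: slice_def)
  then obtain y where y: "y \<in> C" "y i = 1" "below_within {1..n} R x y"
    using assms unfolding normal_at_def by metis
  then have "asym_dist n x (slice C i 1) \<le> enat R"
    unfolding asym_dist_le_iff by (auto simp: slice_def)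
  then have "2 * asym_dist n x (slice C i 1) + 1 \<le> 2 * enat R + 1"
    by (intro add_right_mono mult_left_mono) auto
  then show "2 * asym_dist n x (slice C i 1) + 1 \<le> enat (2 * R + 1)"
    by (simp add: numeral_eq_enat one_enat_def)
qed

lemma normal_at_covers:
  assumes C: "normal_at n R C i" and x: "x \<in> cube n"
  shows "asym_dist n x C \<le> enat R"
proof -
  have i: "i \<in> {1..n}" using C by (simp add: normal_at_def)
  consider "x i = 0" | "x i = 1" using x bit_cube_cases[of x "{1..n}" i] i by (auto simp: cube_eq)
  then have "\<exists>y\<in>C. below_within {1..n} R x y"
  proof cases
    case 1
    obtain a b y z where ab: "a + b \<le> 2 * R + 1" and
      y: "y \<in> C" "below_within {1..n} a x y" and z: "z \<in> C" "below_within {1..n} b x z"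
      using C x 1 unfolding normal_at_def by metis
    have "a \<le> R \<or> b \<le> R" using ab by linarith
    then show ?thesis using y z by (auto simp: below_within_def intro: order.trans)
  next
    case 2
    then show ?thesis using C x unfolding normal_at_def by blast
  qed
  then show ?thesis by (simp add: asym_dist_le_iff)
qed

text \<open>
  A point at distance at least \<open>R\<close> from \<open>C\<close> is as far from each of the two slices, whichever value it
  has at the coordinate \<open>i\<close>.
\<close>

lemma asym_norm_ge:
  assumes x: "x \<in> cube n" "i \<in> {1..n}" and far: "enat R \<le> asym_dist n x C"
  shows "enat (2 * R) \<le> asym_norm n C i"
proof -
  have sub: "enat R \<le> asym_dist n x (slice C i b)" for b
  proof -
    have "asym_dist n x C \<le> asym_dist n x (slice C i b)"
      unfolding asym_dist_def by (rule INF_superset_mono) (auto simp: slice_def)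
    then show ?thesis using far by (rule order.trans[rotated])
  qed
  consider "x i = 0" | "x i = 1"
    using x bit_cube_cases[of x "{1..n}" i] by (auto simp: cube_eq)
  then show ?thesis
  proof cases
    case 1
    have "enat (2 * R) = enat R + enat R" by simp
    also have "\<dots> \<le> asym_dist n x (slice C i 0) + asym_dist n x (slice C i 1)"
      by (intro add_mono sub)
    also have "\<dots> \<le> asym_norm n C i"
      unfolding asym_norm_def
      by (rule max.coboundedI1, rule SUP_upper) (use 1 x in \<open>simp add: slice_def\<close>)
    finally show ?thesis .
  next
    case 2
    have "enat (2 * R) = 2 * enat R" by (simp add: numeral_eq_enat)
    also have "\<dots> \<le> 2 * asym_dist n x (slice C i 1)" by (intro mult_left_mono sub) auto
    also have "\<dots> \<le> 2 * asym_dist n x (slice C i 1) + 1" by simp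
    also have "\<dots> \<le> asym_norm n C i"
      unfolding asym_norm_def
      by (rule max.coboundedI2, rule SUP_upper) (use 2 x in \<open>simp add: slice_def\<close>)
    finally show ?thesis .
  qed
qed

text \<open>
  The sphere covering bound: a codeword covers at most as many points as there are sets of at most
  \<open>r\<close> coordinates in which a covered point can differ from it.
\<close>

lemma card_of_small_radius:
  assumes C: "C \<subseteq> cube n" and cov: "\<And>x. x \<in> cube n \<Longrightarrow> asym_dist n x C \<le> enat r"
  shows "2 ^ n \<le> card C * binomial_upto n r"
proof -
  have fC: "finite C" using C finite_cube finite_subset by blast
  have "cube n \<subseteq> (\<Union>y\<in>C. {x\<in>cube n. below_within {1..n} r x y})"
    using cov by (auto simp: asym_dist_le_iff)
  then have "card (cube n) \<le> card (\<Union>y\<in>C. {x\<in>cube n. below_within {1..n} r x y})"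
    by (rule card_mono[rotated]) (use fC finite_cube in auto)
  also have "\<dots> \<le> (\<Sum>y\<in>C. card {x\<in>cube n. below_within {1..n} r x y})"
    by (rule card_UN_le[OF fC])
  also have "\<dots> \<le> (\<Sum>y\<in>C. binomial_upto n r)"
    by (rule sum_mono) (use C card_points_below[of "{1..n}" _ r] in \<open>auto simp: cube_eq\<close>)
  finally show ?thesis by (simp add: card_cube)
qed

text \<open>
  A code this small cannot have radius below \<open>R\<close>, so some point has distance at least \<open>R\<close>; this point
  bounds from below both the radius and the norms for all coordinates.
\<close>

lemma normal_code_of_normal_at:
  assumes C: "normal_at n R C i" and R: "R \<ge> 1"
    and small: "card C * binomial_upto n (R - 1) < 2 ^ n"
  shows "normal_asym_code n R C"
proof -
  have CC: "C \<subseteq> cube n" and i: "i \<in> {1..n}" using C by (auto simp: normal_at_def)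
  obtain x where x: "x \<in> cube n" and far: "\<not> asym_dist n x C \<le> enat (R - 1)"
    using card_of_small_radius[OF CC, of "R - 1"] small by fastforce
  have far': "enat R \<le> asym_dist n x C"
    using far R by (cases "asym_dist n x C") auto
  have "asym_covering_radius n C = enat R"
    unfolding asym_covering_radius_def
  proof (rule antisym)
    show "(INF r\<in>{r. \<forall>x\<in>cube n. asym_dist n x C \<le> enat r}. enat r) \<le> enat R"
      by (rule INF_lower) (use normal_at_covers[OF C] in auto)
    show "enat R \<le> (INF r\<in>{r. \<forall>x\<in>cube n. asym_dist n x C \<le> enat r}. enat r)"
      by (rule INF_greatest) (use far' x in \<open>blast intro: order.trans\<close>)
  qed
  then have code: "asym_code n R C" using CC by (simp add: asym_code_def)
  have up: "min_asym_norm n C \<le> enat (2 * R + 1)"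
    unfolding min_asym_norm_def
    by (rule INF_lower2[OF i]) (rule asym_norm_le_of_normal_at[OF C])
  have lo: "enat (2 * R) \<le> min_asym_norm n C"
    unfolding min_asym_norm_def by (rule INF_greatest) (rule asym_norm_ge[OF x _ far'])
  have "min_asym_norm n C \<in> {enat (2 * R), enat (2 * R + 1)}"
    using up lo by (cases "min_asym_norm n C") auto
  then show ?thesis using code up by (simp add: normal_asym_code_def)
qed

text \<open>
  The two sums have orders \<open>n^R\<close> and \<open>n^(R - 1)\<close>, so a code of bounded density is eventually too small
  to have radius below \<open>R\<close>.
\<close>

lemma binomial_upto_half_over_lower_at_top:
  assumes R: "R \<ge> 1"
  shows "filterlim (\<lambda>n. real (binomial_upto (n div 2) R) / real (binomial_upto n (R - 1)))
    at_top sequentially"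
proof -
  have half: "(\<lambda>n. real (n div 2) / real n) \<longlonglongrightarrow> 1 / 2" using div_over_tendsto[of 2] by simp
  have "(\<lambda>n. (real (binomial_upto (n div 2) R) / real n ^ R)
        / (real (binomial_upto n (R - 1)) / real n ^ (R - 1)))
      \<longlonglongrightarrow> ((1 / 2) ^ R / fact R) / (1 / fact (R - 1))"
    by (intro tendsto_divide binomial_upto_linear_tendsto binomial_upto_over_power_tendsto half) auto
  then have "filterlim (\<lambda>n. (real (binomial_upto (n div 2) R) / real n ^ R)
        / (real (binomial_upto n (R - 1)) / real n ^ (R - 1)) * real n) at_top sequentially"
    by (rule filterlim_tendsto_pos_mult_at_top[OF _ _ filterlim_real_sequentially]) simp
  moreover have "\<forall>\<^sub>F n in sequentially. (real (binomial_upto (n div 2) R) / real n ^ R)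
        / (real (binomial_upto n (R - 1)) / real n ^ (R - 1)) * real n
      = real (binomial_upto (n div 2) R) / real (binomial_upto n (R - 1))"
    using eventually_gt_at_top[of 0]
  proof eventually_elim
    case (elim n)
    have "real n ^ R = real n ^ (R - 1) * real n" using R by (metis power_minus_mult less_le_trans zero_less_one)
    then show ?case using elim by simp
  qed
  ultimately show ?thesis by (subst (asm) filterlim_cong[OF refl refl]) auto
qed

theorem theorem8:
  fixes R :: nat
  assumes "R \<ge> 2"
  shows "limsup_normal_density R
           \<le> ereal (exp 1 * (real R * ln (real R) + ln (real R) + ln (ln (real R)) + 4))"
proof -
  define t where "t = exp 1 * (real R * ln (real R) + ln (real R) + ln (ln (real R)) + 4)"
  have "\<forall>\<^sub>F n in sequentially. min_density R n \<le> t"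
    unfolding t_def by (rule min_density_eventually_le[OF assms])
  moreover have "\<forall>\<^sub>F n in sequentially.
      t < real (binomial_upto (n div 2) R) / real (binomial_upto n (R - 1))"
    using binomial_upto_half_over_lower_at_top[of R] assms by (simp add: filterlim_at_top_dense)
  ultimately have "\<forall>\<^sub>F n in sequentially. normal_density n R \<le> ereal t"
    using eventually_ge_at_top[of 1]
  proof eventually_elim
    case (elim n)
    define \<beta> where "\<beta> = real (binomial_upto (n div 2) R)"
    define \<gamma> where "\<gamma> = real (binomial_upto n (R - 1))"
    have pos: "\<beta> > 0" "\<gamma> > 0"
      using binomial_upto_pos[of "n div 2" R] binomial_upto_pos[of n "R - 1"]
      by (auto simp: \<beta>_def \<gamma>_def)
    obtain C i where C: "normal_at n R C i" "card C = min_size R n"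
      using min_size_attained[OF elim(3)] .
    have dens: "min_density R n = real (card C) * \<beta> / 2 ^ n"
      by (simp add: min_density_def C(2) \<beta>_def)
    have "real (card C) * \<beta> / 2 ^ n < \<beta> / \<gamma>"
      using elim(1,2) dens by (simp add: \<beta>_def \<gamma>_def)
    then have "real (card C) * \<gamma> < 2 ^ n"
      using pos by (simp add: field_simps)
    then have "real (card C * binomial_upto n (R - 1)) < real (2 ^ n)"
      by (simp add: \<gamma>_def)
    then have "normal_asym_code n R C"
      using normal_code_of_normal_at[OF C(1)] assms by (simp only: of_nat_less_iff)
    then have "K_normal n R \<le> enat (card C)"
      unfolding K_normal_def by (intro INF_lower) simp
    then have "ereal_of_enat (K_normal n R) \<le> ereal (real (card C))"
      by (metis ereal_of_enat_le_iff ereal_of_enat_simps(1))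
    then have "normal_density n R \<le> ereal (real (card C)) / ereal (2 ^ n / \<beta>)"
      unfolding normal_density_def \<beta>_def[symmetric] using pos
      by (intro ereal_divide_right_mono) auto
    also have "\<dots> = ereal (min_density R n)"
      using pos dens by simp
    also have "\<dots> \<le> ereal t" using elim(1) by simp
    finally show ?case .
  qed
  then show ?thesis
    unfolding limsup_normal_density_def t_def[symmetric] by (rule Limsup_bounded)
qed

end
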